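(* Let $d\ge1$, let $w\ne0$ and $\alpha$ be complex numbers, and let $\{P_n\}_{n\ge0}$ be a monic $d$-orthogonal polynomial sequence such that, with $Q_n=(n+1)^{-1}\Delta_wP_{n+1}$, $$P_n(x)=Q_n(x)-n\alpha\,Q_{n-1}(x),\qquad n\ge0\quad(Q_{-1}=0).$$ Let $\beta_n,\gamma_n^{k}$ be the recurrence coefficients of $\{P_n\}$. Then $\{P_n\}$ satisfies the following $(d+1)$-order difference equation, for all $n\ge d$: \begin{align*} (n-d)P_{n-d}(x)&=\left[x+(d+1)w-(d+1)\alpha(n-d+1)-\beta_n\right]\Delta_wP_{n-d}(x)\\ &\quad+\sum_{i=1}^{d}\left\{\alpha^i\left[\binom{d}{i}(x+(d+1)w-\beta_n)-\alpha\binom{d+1}{i+1}(n-d+i+1)\right]\right.\\ &\qquad\left.-\sum_{j=0}^{i-1}\binom{d-1-j}{i-1-j}\alpha^{i-1-j}\frac{\gamma_{n-j}^{d-1-j}}{\langle n\rangle_{j+1}}\right\}\Delta_w^{i+1}P_{n-d}(x). \end{align*}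
   Context: $\Delta_wf(x)=\dfrac{f(x+w)-f(x)}{w}$, and $\langle n\rangle_k=n(n-1)\cdots(n-k+1)$, $\langle n\rangle_0=1$, is the falling factorial. A sequence of monic polynomials $\{P_n\}_{n\ge0}$ with $\deg P_n=n$ (complex coefficients) is a $d$-orthogonal polynomial sequence if there are linear functionals $u_0,\dots,u_{d-1}$ on polynomials such that, for each $0\le r\le d-1$ and all $m\ge0$: $\langle u_r,x^mP_n\rangle=0$ for $n\ge md+r+1$, and $\langle u_r,x^mP_{md+r}\rangle\ne0$. Equivalently (a known analogue of Favard's theorem), $P_0=1$ and $$P_{n+1}(x)=(x-\beta_n)P_n(x)-\sum_{\nu=0}^{d-1}\gamma_{n-\nu}^{d-1-\nu}P_{n-1-\nu}(x),\qquad n\ge0,$$ with $P_m=0$ for $m<0$ and $\gamma_m^0\neq0$ for $m\ge1$. The superscripts of $\gamma$ are indices, not powers. These $\beta_n,\gamma_n^k$ are the recurrence coefficients. *)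

theory Defs
  imports Complex_Main "HOL-Computational_Algebra.Polynomial"
begin

definition Delta :: "complex \<Rightarrow> complex poly \<Rightarrow> complex poly" where
  "Delta w f = smult (1 / w) (pcompose f [:w, 1:] - f)"

lemma poly_Delta: "poly (Delta w f) x = (poly f (x + w) - poly f x) / w"
  by (simp add: Delta_def poly_pcompose add.commute)

definition falling_factorial :: "complex \<Rightarrow> nat \<Rightarrow> complex" where
  "falling_factorial a k = (\<Prod>i<k. a - of_nat i)"

definition monic_poly_seq :: "(nat \<Rightarrow> complex poly) \<Rightarrow> bool" where
  "monic_poly_seq P \<longleftrightarrow> (\<forall>n. degree (P n) = n \<and> lead_coeff (P n) = 1)"

text \<open>
  The functionals are linear over the complex numbers, hence the explicit scalar
  multiplications (the unqualified constant for linear maps is real-linear).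
\<close>

definition d_orthogonal :: "nat \<Rightarrow> (nat \<Rightarrow> complex poly) \<Rightarrow> bool" where
  "d_orthogonal d P \<longleftrightarrow>
     monic_poly_seq P \<and>
     (\<exists>u :: nat \<Rightarrow> complex poly \<Rightarrow> complex.
        \<forall>r<d. Vector_Spaces.linear smult (*) (u r) \<and>
          (\<forall>m. (\<forall>n \<ge> m * d + r + 1. u r (monom 1 m * P n) = 0) \<and>
               u r (monom 1 m * P (m * d + r)) \<noteq> 0))"

text \<open>
  Below, \<open>\<gamma> k m\<close> is the coefficient with superscript \<open>k\<close> and subscript \<open>m\<close>;
  the case distinction encodes the convention that polynomials of negative index vanish.
\<close>

definition recurrence_coeffs ::
  "nat \<Rightarrow> (nat \<Rightarrow> complex poly) \<Rightarrow> (nat \<Rightarrow> complex) \<Rightarrow> (nat \<Rightarrow> nat \<Rightarrow> complex) \<Rightarrow> bool" where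
  "recurrence_coeffs d P \<beta> \<gamma> \<longleftrightarrow>
     P 0 = 1 \<and>
     (\<forall>n. P (n + 1) = [:- \<beta> n, 1:] * P n -
        (\<Sum>\<nu><d. if \<nu> + 1 \<le> n then smult (\<gamma> (d - 1 - \<nu>) (n - \<nu>)) (P (n - 1 - \<nu>)) else 0)) \<and>
     (\<forall>m\<ge>1. \<gamma> 0 m \<noteq> 0)"

definition Delta_derived :: "complex \<Rightarrow> (nat \<Rightarrow> complex poly) \<Rightarrow> nat \<Rightarrow> complex poly" where
  "Delta_derived w P n = smult (1 / of_nat (n + 1)) (Delta w (P (n + 1)))"

end

theory Submission
  imports Defs
begin

text \<open>
  Put \<open>D = \<Delta>\<^sub>w\<close> and \<open>T = 1 + \<alpha> D\<close>. The relation between \<open>P\<close> and its normalised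
  differences says exactly that \<open>D P\<^sub>n\<^sub>+\<^sub>1 = (n + 1) T P\<^sub>n\<close>, a twisted Appell property.
  As \<open>D\<close> and \<open>T\<close> commute, it iterates to
  \<open>D\<^sup>k P\<^sub>N\<^sub>+\<^sub>k = \<langle>N + k\<rangle>\<^sub>k T\<^sup>k P\<^sub>N\<close> (lemma \<open>funpow_Delta_twisted_Appell\<close>): enough
  differences bring every member of the sequence down to a fixed \<open>P\<^sub>N\<close>.

  Now let \<open>N = n - d\<close> and apply \<open>D\<^sup>d\<^sup>+\<^sup>1\<close> to the recurrence that expresses \<open>P\<^sub>n\<^sub>+\<^sub>1\<close>. The
  factor \<open>x\<close> is handled by the product rule
  \<open>D\<^sup>k (x f) = (x + k w) D\<^sup>k f + k D\<^sup>k\<^sup>-\<^sup>1 f\<close>, and the order \<open>d + 1\<close> is high enough to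
  reduce all terms to \<open>P\<^sub>N\<close>. Every falling factorial that appears is
  \<open>\<langle>n\<rangle>\<^sub>d \<noteq> 0\<close> times \<open>n + 1\<close>, \<open>1\<close> or \<open>1 / \<langle>n\<rangle>\<^sub>\<nu>\<^sub>+\<^sub>1\<close>; after division by \<open>\<langle>n\<rangle>\<^sub>d\<close>,
  \<open>(n + 1) T\<^sup>d\<^sup>+\<^sup>1 P\<^sub>N = (x + (d + 1) w - \<beta>\<^sub>n) D T\<^sup>d P\<^sub>N + (d + 1) T\<^sup>d P\<^sub>N - R\<close>, where \<open>R\<close> is the sum over
  \<open>\<nu> < d\<close> of \<open>D\<^sup>\<nu>\<^sup>+\<^sup>2 T\<^sup>d\<^sup>-\<^sup>1\<^sup>-\<^sup>\<nu> P\<^sub>N\<close> with coefficients \<open>\<gamma> (d - 1 - \<nu>) (n - \<nu>) / \<langle>n\<rangle>\<^sub>\<nu>\<^sub>+\<^sub>1\<close>.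
  Expanding the powers of \<open>T\<close> by the binomial theorem and collecting the coefficient of
  each \<open>D\<^sup>i\<^sup>+\<^sup>1 P\<^sub>N\<close> gives the difference equation; the two terms without a factor \<open>x\<close> or
  \<open>\<gamma>\<close> combine through \<open>(d + 1) (d choose k) = (d + 1 - k) (d + 1 choose k)\<close>.
\<close>

section \<open>The difference operator\<close>

lemma Delta_add: "Delta w (f + g) = Delta w f + Delta w g"
  by (simp add: Delta_def pcompose_add smult_diff_right smult_add_right)

lemma Delta_smult: "Delta w (smult c f) = smult c (Delta w f)"
  by (simp add: Delta_def pcompose_smult smult_diff_right mult.commute)

lemma Delta_diff: "Delta w (f - g) = Delta w f - Delta w g"
  by (simp add: Delta_def pcompose_diff smult_diff_right)

lemma Delta_0: "Delta w 0 = 0"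
  by (simp add: Delta_def)

lemma funpow_Delta_add:
  "(Delta w ^^ k) (f + g) = (Delta w ^^ k) f + (Delta w ^^ k) g"
  by (induction k) (simp_all add: Delta_add)

lemma funpow_Delta_smult:
  "(Delta w ^^ k) (smult c f) = smult c ((Delta w ^^ k) f)"
  by (induction k) (simp_all add: Delta_smult)

lemma funpow_Delta_diff:
  "(Delta w ^^ k) (f - g) = (Delta w ^^ k) f - (Delta w ^^ k) g"
  by (induction k) (simp_all add: Delta_diff)

lemma funpow_Delta_0: "(Delta w ^^ k) 0 = 0"
  by (induction k) (simp_all add: Delta_0)

lemma funpow_Delta_sum:
  "(Delta w ^^ k) (\<Sum>i\<in>A. f i) = (\<Sum>i\<in>A. (Delta w ^^ k) (f i))"
  by (induction A rule: infinite_finite_induct)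
     (simp_all add: funpow_Delta_add funpow_Delta_0)

lemma Delta_linear_factor_mult:
  assumes "w \<noteq> 0"
  shows "Delta w ([:a, 1:] * f) = [:a + w, 1:] * Delta w f + f"
  using assms
  by (simp add: poly_eq_poly_eq_iff [symmetric] fun_eq_iff poly_Delta field_simps
      del: mult_pCons_left)

text \<open>
  The Leibniz rule for \<open>D\<^sup>k\<close> has only two terms here because the second difference of a
  linear factor vanishes; each difference also shifts the factor by \<open>w\<close>.
\<close>

lemma funpow_Delta_linear_factor_mult:
  assumes "w \<noteq> 0"
  shows "(Delta w ^^ Suc k) ([:a, 1:] * f) =
           [:a + of_nat (Suc k) * w, 1:] * (Delta w ^^ Suc k) f
           + smult (of_nat (Suc k)) ((Delta w ^^ k) f)"
proof (induction k)
  case 0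
  then show ?case
    using assms by (simp add: Delta_linear_factor_mult del: mult_pCons_left)
next
  case (Suc k)
  have "(Delta w ^^ Suc (Suc k)) ([:a, 1:] * f) =
          Delta w ([:a + of_nat (Suc k) * w, 1:] * (Delta w ^^ Suc k) f
            + smult (of_nat (Suc k)) ((Delta w ^^ k) f))"
    using Suc.IH by simp
  also have "\<dots> = [:a + of_nat (Suc k) * w + w, 1:] * (Delta w ^^ Suc (Suc k)) f
            + (Delta w ^^ Suc k) f + smult (of_nat (Suc k)) ((Delta w ^^ Suc k) f)"
    using assms
    by (simp add: Delta_add Delta_smult Delta_linear_factor_mult del: mult_pCons_left)
  also have "a + of_nat (Suc k) * w + w = a + of_nat (Suc (Suc k)) * w"
    by (simp add: algebra_simps)
  finally show ?case
    by (simp only: of_nat_Suc [of "Suc k"] smult_add_left smult_1_left add.assoc)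
qed

section \<open>Falling factorials\<close>

lemma falling_factorial_Suc:
  "falling_factorial a (Suc k) = a * falling_factorial (a - 1) k"
  unfolding falling_factorial_def
  by (subst prod.lessThan_Suc_shift) (simp add: algebra_simps)

lemma falling_factorial_add:
  "falling_factorial a (j + k) = falling_factorial a j * falling_factorial (a - of_nat j) k"
  by (induction j arbitrary: a) (simp_all add: falling_factorial_Suc falling_factorial_def[of _ 0] algebra_simps)

lemma falling_factorial_of_nat_nonzero:
  assumes "k \<le> n"
  shows "falling_factorial (of_nat n) k \<noteq> 0"
  using assms by (auto simp: falling_factorial_def)

section \<open>Reduction of the sequence to one of its members\<close>

text \<open>The binomial expansion of \<open>(1 + \<alpha> D)\<^sup>k\<close>, as a recursion in \<open>k\<close>.\<close>

lemma binomial_sum_Suc: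
  fixes f :: "nat \<Rightarrow> 'a::comm_ring_1"
  shows "(\<Sum>j\<le>Suc k. of_nat (Suc k choose j) * \<alpha> ^ j * f j) =
    (\<Sum>j\<le>k. of_nat (k choose j) * \<alpha> ^ j * f j)
    + \<alpha> * (\<Sum>j\<le>k. of_nat (k choose j) * \<alpha> ^ j * f (Suc j))"
proof -
  have "(\<Sum>j\<le>Suc k. of_nat (Suc k choose j) * \<alpha> ^ j * f j) =
     f 0 + (\<Sum>j\<le>k. of_nat (k choose Suc j) * \<alpha> ^ Suc j * f (Suc j))
     + \<alpha> * (\<Sum>j\<le>k. of_nat (k choose j) * \<alpha> ^ j * f (Suc j))"
    by (subst sum.atMost_Suc_shift)
       (simp add: sum_distrib_left sum.distrib algebra_simps)
  also have "f 0 + (\<Sum>j\<le>k. of_nat (k choose Suc j) * \<alpha> ^ Suc j * f (Suc j)) =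
      (\<Sum>j\<le>Suc k. of_nat (k choose j) * \<alpha> ^ j * f j)"
    by (subst sum.atMost_Suc_shift) simp
  also have "\<dots> = (\<Sum>j\<le>k. of_nat (k choose j) * \<alpha> ^ j * f j)"
    by (simp add: binomial_eq_0)
  finally show ?thesis .
qed

text \<open>
  The values of \<open>D\<^sup>m\<^sup>+\<^sup>k P\<^sub>N\<^sub>+\<^sub>k = \<langle>N + k\<rangle>\<^sub>k D\<^sup>m T\<^sup>k P\<^sub>N\<close> with \<open>T\<^sup>k\<close> expanded. The extra order \<open>m\<close> is
  what the induction needs, since every factor \<open>T\<close> brings in one more \<open>D\<close>.
\<close>

lemma funpow_Delta_twisted_Appell:
  assumes Appell: "\<And>n. Delta w (P (Suc n)) = smult (of_nat (Suc n)) (P n + smult \<alpha> (Delta w (P n)))"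
  shows "poly ((Delta w ^^ (m + k)) (P (N + k))) x =
     falling_factorial (of_nat (N + k)) k *
     (\<Sum>j\<le>k. of_nat (k choose j) * \<alpha> ^ j * poly ((Delta w ^^ (m + j)) (P N)) x)"
proof (induction k arbitrary: m)
  case 0
  then show ?case by (simp add: falling_factorial_def)
next
  case (Suc k)
  have "(Delta w ^^ (m + Suc k)) (P (N + Suc k)) = (Delta w ^^ (m + k)) (Delta w (P (Suc (N + k))))"
    by (simp add: funpow_swap1)
  also have "\<dots> = smult (of_nat (N + Suc k)) ((Delta w ^^ (m + k)) (P (N + k))
      + smult \<alpha> ((Delta w ^^ (Suc m + k)) (P (N + k))))"
    unfolding Appell by (simp add: funpow_Delta_add funpow_Delta_smult funpow_swap1)
  finally have "poly ((Delta w ^^ (m + Suc k)) (P (N + Suc k))) x =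
      of_nat (N + Suc k) * (poly ((Delta w ^^ (m + k)) (P (N + k))) x
        + \<alpha> * poly ((Delta w ^^ (Suc m + k)) (P (N + k))) x)"
    by simp
  also have "\<dots> = of_nat (N + Suc k) * falling_factorial (of_nat (N + k)) k *
      ((\<Sum>j\<le>k. of_nat (k choose j) * \<alpha> ^ j * poly ((Delta w ^^ (m + j)) (P N)) x)
       + \<alpha> * (\<Sum>j\<le>k. of_nat (k choose j) * \<alpha> ^ j * poly ((Delta w ^^ (m + Suc j)) (P N)) x))"
    unfolding Suc.IH by (simp add: algebra_simps)
  also have "of_nat (N + Suc k) * falling_factorial (of_nat (N + k)) k =
      falling_factorial (of_nat (N + Suc k)) (Suc k)"
    by (simp add: falling_factorial_Suc)
  also have "((\<Sum>j\<le>k. of_nat (k choose j) * \<alpha> ^ j * poly ((Delta w ^^ (m + j)) (P N)) x)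
       + \<alpha> * (\<Sum>j\<le>k. of_nat (k choose j) * \<alpha> ^ j * poly ((Delta w ^^ (m + Suc j)) (P N)) x)) =
      (\<Sum>j\<le>Suc k. of_nat (Suc k choose j) * \<alpha> ^ j * poly ((Delta w ^^ (m + j)) (P N)) x)"
    by (rule binomial_sum_Suc [symmetric])
  finally show ?case .
qed

section \<open>Collecting coefficients\<close>

lemma sum_triangle_diagonals:
  fixes h :: "nat \<Rightarrow> nat \<Rightarrow> 'a::comm_monoid_add"
  shows "(\<Sum>\<nu><d. \<Sum>k\<le>d - 1 - \<nu>. h \<nu> k) = (\<Sum>i=1..d. \<Sum>j<i. h j (i - 1 - j))"
proof -
  have "(\<Sum>\<nu><d. \<Sum>k\<le>d - 1 - \<nu>. h \<nu> k) = (\<Sum>\<nu><d. \<Sum>k<d - \<nu>. h \<nu> k)"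
    by (intro sum.cong) auto
  also have "\<dots> = (\<Sum>(\<nu>, k)\<in>Sigma {..<d} (\<lambda>\<nu>. {..<d - \<nu>}). h \<nu> k)"
    by (simp add: sum.Sigma)
  also have "Sigma {..<d} (\<lambda>\<nu>. {..<d - \<nu>}) = {(i, j). i + j < d}"
    by auto
  also have "(\<Sum>(\<nu>, k)\<in>{(i, j). i + j < d}. h \<nu> k) = (\<Sum>k<d. \<Sum>i\<le>k. h i (k - i))"
    by (rule sum.triangle_reindex)
  also have "\<dots> = (\<Sum>i=1..d. \<Sum>j<i. h j (i - 1 - j))"
    by (rule sum.reindex_bij_witness [of _ "\<lambda>i. i - 1" Suc]) (auto simp: lessThan_Suc_atMost)
  finally show ?thesis .
qed

text \<open>
  The contribution of \<open>(n + 1) T\<^sup>d\<^sup>+\<^sup>1 - (d + 1) T\<^sup>d\<close> with \<open>n = N + d\<close>: by the absorption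
  identity the coefficient of \<open>\<alpha>\<^sup>k D\<^sup>k\<close> is \<open>(N + k) (d + 1 choose k)\<close>.
\<close>

lemma binomial_sum_difference:
  fixes A :: "nat \<Rightarrow> 'a::comm_ring_1"
  shows "of_nat (N + d + 1) * (\<Sum>k\<le>d + 1. of_nat (d + 1 choose k) * \<alpha> ^ k * A k)
      - of_nat (d + 1) * (\<Sum>k\<le>d. of_nat (d choose k) * \<alpha> ^ k * A k) =
    of_nat N * A 0
      + (\<Sum>i\<le>d. of_nat (N + i + 1) * of_nat (d + 1 choose (i + 1)) * \<alpha> ^ (i + 1) * A (i + 1))"
proof -
  have absorb: "of_nat (N + d + 1) * of_nat (d + 1 choose k) - of_nat (d + 1) * of_nat (d choose k) =
      (of_nat (N + k) * of_nat (d + 1 choose k) :: 'a)" if "k \<le> d + 1" for k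
  proof -
    have "(d + 1 - k) * (d + 1 choose k) = (d + 1) * (d choose k)"
      using binomial_absorb_comp [of "d + 1" k] by simp
    then have "(N + d + 1) * (d + 1 choose k) = (N + k) * (d + 1 choose k) + (d + 1) * (d choose k)"
      using that by (metis (no_types, lifting) add.assoc add_mult_distrib le_add_diff_inverse)
    then have "of_nat ((N + d + 1) * (d + 1 choose k)) =
        (of_nat ((N + k) * (d + 1 choose k) + (d + 1) * (d choose k)) :: 'a)"
      by (rule arg_cong)
    then show ?thesis
      by (simp only: of_nat_mult of_nat_add) (simp add: algebra_simps)
  qed
  have "of_nat (N + d + 1) * (\<Sum>k\<le>d + 1. of_nat (d + 1 choose k) * \<alpha> ^ k * A k)
      - of_nat (d + 1) * (\<Sum>k\<le>d. of_nat (d choose k) * \<alpha> ^ k * A k) =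
     of_nat (N + d + 1) * (\<Sum>k\<le>d + 1. of_nat (d + 1 choose k) * \<alpha> ^ k * A k)
      - of_nat (d + 1) * (\<Sum>k\<le>d + 1. of_nat (d choose k) * \<alpha> ^ k * A k)"
    by (simp add: binomial_eq_0)
  also have "\<dots> = (\<Sum>k\<le>d + 1. (of_nat (N + d + 1) * of_nat (d + 1 choose k)
      - of_nat (d + 1) * of_nat (d choose k)) * (\<alpha> ^ k * A k))"
    unfolding sum_distrib_left sum_subtractf [symmetric] left_diff_distrib
    by (simp only: mult.assoc)
  also have "\<dots> = (\<Sum>k\<le>d + 1. of_nat (N + k) * of_nat (d + 1 choose k) * (\<alpha> ^ k * A k))"
    by (intro sum.cong refl arg_cong2 [where f = "(*)"] absorb) simp
  also have "\<dots> = of_nat N * A 0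
      + (\<Sum>i\<le>d. of_nat (N + i + 1) * of_nat (d + 1 choose (i + 1)) * \<alpha> ^ (i + 1) * A (i + 1))"
    unfolding Suc_eq_plus1 [symmetric] sum.atMost_Suc_shift by (simp add: mult.assoc)
  finally show ?thesis .
qed

text \<open>
  The difference equation is the binomially expanded operator identity with the coefficients
  collected; this holds for arbitrary values \<open>A i\<close> in place of those of \<open>D\<^sup>i P\<^sub>N\<close> at \<open>x\<close>. Here
  \<open>X\<close> stands for \<open>x + (d + 1) w - \<beta>\<^sub>n\<close> and \<open>g \<nu>\<close> for the quotient of \<open>\<gamma>\<close> by the falling
  factorial.
\<close>

lemma collect_difference_coefficients:
  fixes A g :: "nat \<Rightarrow> 'a::comm_ring_1"
  assumes expanded: "of_nat (N + d + 1) * (\<Sum>k\<le>d + 1. of_nat (d + 1 choose k) * \<alpha> ^ k * A k) =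
      X * (\<Sum>k\<le>d. of_nat (d choose k) * \<alpha> ^ k * A (k + 1))
      + of_nat (d + 1) * (\<Sum>k\<le>d. of_nat (d choose k) * \<alpha> ^ k * A k)
      - (\<Sum>\<nu><d. g \<nu> * (\<Sum>k\<le>d - 1 - \<nu>. of_nat (d - 1 - \<nu> choose k) * \<alpha> ^ k * A (\<nu> + 2 + k)))"
  shows "of_nat N * A 0 = (X - of_nat (d + 1) * \<alpha> * of_nat (N + 1)) * A 1
      + (\<Sum>i = 1..d. (\<alpha> ^ i * (of_nat (d choose i) * X
                      - \<alpha> * of_nat (d + 1 choose (i + 1)) * of_nat (N + i + 1))
           - (\<Sum>j<i. of_nat (d - 1 - j choose (i - 1 - j)) * \<alpha> ^ (i - 1 - j) * g j)) * A (i + 1))"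
proof -
  define F where "F i = \<alpha> ^ i * (of_nat (d choose i) * X
      - \<alpha> * of_nat (d + 1 choose (i + 1)) * of_nat (N + i + 1)) * A (i + 1)" for i
  define G where "G i = (\<Sum>j<i. of_nat (d - 1 - j choose (i - 1 - j)) * \<alpha> ^ (i - 1 - j) * g j)
      * A (i + 1)" for i
  have "(\<Sum>\<nu><d. g \<nu> * (\<Sum>k\<le>d - 1 - \<nu>. of_nat (d - 1 - \<nu> choose k) * \<alpha> ^ k * A (\<nu> + 2 + k))) =
      (\<Sum>i=1..d. \<Sum>j<i. g j * (of_nat (d - 1 - j choose (i - 1 - j)) * \<alpha> ^ (i - 1 - j)
         * A (j + 2 + (i - 1 - j))))"
    unfolding sum_distrib_left by (rule sum_triangle_diagonals)
  also have "\<dots> = (\<Sum>i=1..d. G i)"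
    unfolding G_def sum_distrib_right
    by (intro sum.cong refl) (simp add: mult_ac)
  finally have gamma: "(\<Sum>\<nu><d. g \<nu> * (\<Sum>k\<le>d - 1 - \<nu>. of_nat (d - 1 - \<nu> choose k) * \<alpha> ^ k
      * A (\<nu> + 2 + k))) = (\<Sum>i=1..d. G i)" .
  have "(\<Sum>i\<le>d. F i) = X * (\<Sum>k\<le>d. of_nat (d choose k) * \<alpha> ^ k * A (k + 1))
      - (\<Sum>i\<le>d. of_nat (N + i + 1) * of_nat (d + 1 choose (i + 1)) * \<alpha> ^ (i + 1) * A (i + 1))"
    unfolding F_def sum_distrib_left sum_subtractf [symmetric]
    by (intro sum.cong refl) (simp add: algebra_simps)
  moreover have "a = f - c" if "f = p - s" "p + e - c - e = a + s" for a c e f p s :: 'a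
  proof -
    have "a = (p + e - c - e) - s" using that(2) by simp
    with that(1) show ?thesis by simp
  qed
  ultimately have "of_nat N * A 0 = (\<Sum>i\<le>d. F i) - (\<Sum>i=1..d. G i)"
    using binomial_sum_difference [of N d \<alpha> A, unfolded expanded gamma] by blast
  also have "(\<Sum>i\<le>d. F i) = F 0 + (\<Sum>i=1..d. F i)"
    by (simp add: sum.atLeast_Suc_atMost atMost_atLeast0)
  also have "F 0 + (\<Sum>i=1..d. F i) - (\<Sum>i=1..d. G i) = F 0 + (\<Sum>i=1..d. F i - G i)"
    by (simp add: sum_subtractf)
  also have "F 0 = (X - of_nat (d + 1) * \<alpha> * of_nat (N + 1)) * A 1"
    by (simp add: F_def mult_ac)
  finally show ?thesis
    unfolding F_def G_def left_diff_distrib .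
qed

section \<open>The difference equation\<close>

theorem corollary3p6:
  fixes d :: nat and w \<alpha> :: complex
    and P Q :: "nat \<Rightarrow> complex poly"
    and \<beta> :: "nat \<Rightarrow> complex" and \<gamma> :: "nat \<Rightarrow> nat \<Rightarrow> complex"
  assumes "d \<ge> 1" and "w \<noteq> 0"
    and "d_orthogonal d P"
    and "\<And>n. Q n = Delta_derived w P n"
    and "\<And>n. P n = Q n - (if n = 0 then 0 else smult (of_nat n * \<alpha>) (Q (n - 1)))"
    and "recurrence_coeffs d P \<beta> \<gamma>"
  shows "\<forall>n\<ge>d. \<forall>x::complex.
    of_nat (n - d) * poly (P (n - d)) x =
      (x + of_nat (d + 1) * w - of_nat (d + 1) * \<alpha> * of_nat (n - d + 1) - \<beta> n)
        * poly (Delta w (P (n - d))) x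
      + (\<Sum>i = 1..d.
          (\<alpha> ^ i * (of_nat (d choose i) * (x + of_nat (d + 1) * w - \<beta> n)
                    - \<alpha> * of_nat ((d + 1) choose (i + 1)) * of_nat (n - d + i + 1))
           - (\<Sum>j<i. of_nat ((d - 1 - j) choose (i - 1 - j)) * \<alpha> ^ (i - 1 - j)
                * (\<gamma> (d - 1 - j) (n - j) / falling_factorial (of_nat n) (j + 1))))
          * poly ((Delta w ^^ (i + 1)) (P (n - d))) x)"
proof (intro allI impI)
  fix n :: nat and x :: complex
  assume "d \<le> n"
  define N where "N = n - d"
  have n: "n = N + d" using \<open>d \<le> n\<close> by (simp add: N_def)
  have P_0: "P 0 = 1"
    and rec: "P (n + 1) = [:- \<beta> n, 1:] * P n -
      (\<Sum>\<nu><d. if \<nu> + 1 \<le> n then smult (\<gamma> (d - 1 - \<nu>) (n - \<nu>)) (P (n - 1 - \<nu>)) else 0)"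
    using assms(6) by (auto simp: recurrence_coeffs_def)
  have Appell: "Delta w (P (Suc m)) = smult (of_nat (Suc m)) (P m + smult \<alpha> (Delta w (P m)))" for m
  proof -
    have Q: "Delta w (P (Suc k)) = smult (of_nat (Suc k)) (Q k)" for k
      using assms(4) [of k] by (simp add: Delta_derived_def del: of_nat_Suc)
    show ?thesis
    proof (cases m)
      case 0
      have "Delta w (P 0) = 0"
        by (simp add: P_0 Delta_def one_pCons)
      with 0 show ?thesis
        using assms(5) [of 0] Q [of 0] by simp
    next
      case (Suc l)
      then have "P m = Q m - smult \<alpha> (Delta w (P m))"
        using assms(5) [of m] Q [of l] by (simp add: mult.commute)
      then have "P m + smult \<alpha> (Delta w (P m)) = Q m"
        by (metis diff_add_cancel)
      then show ?thesis
        using Q [of m] by simp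
    qed
  qed
  note reduce = funpow_Delta_twisted_Appell [of w P \<alpha>, OF Appell]
  let ?A = "\<lambda>i. poly ((Delta w ^^ i) (P N)) x"
  let ?S = "\<lambda>k m. \<Sum>j\<le>k. of_nat (k choose j) * \<alpha> ^ j * ?A (m + j)"
  let ?X = "x + of_nat (d + 1) * w - \<beta> n"
  let ?g = "\<lambda>\<nu>. \<gamma> (d - 1 - \<nu>) (n - \<nu>) / falling_factorial (of_nat n) (\<nu> + 1)"
  let ?c = "falling_factorial (of_nat n) d"
  have c: "?c \<noteq> 0"
    using \<open>d \<le> n\<close> by (rule falling_factorial_of_nat_nonzero)

  have lhs: "poly ((Delta w ^^ (d + 1)) (P (n + 1))) x = ?c * (of_nat (N + d + 1) * ?S (d + 1) 0)"
    using reduce [of 0 "d + 1" N x] by (simp add: n falling_factorial_Suc algebra_simps)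
  have lin1: "poly ((Delta w ^^ (d + 1)) (P n)) x = ?c * ?S d 1"
    using reduce [of 1 d N x] by (simp add: n)
  have lin0: "poly ((Delta w ^^ d) (P n)) x = ?c * ?S d 0"
    using reduce [of 0 d N x] by (simp add: n)
  \<comment> \<open>\<open>d + 1\<close> splits as \<open>\<nu> + 2\<close> and the \<open>d - 1 - \<nu>\<close> differences that lead down to \<open>P N\<close>; the falling
     factorial of the latter is the tail of \<open>\<langle>n\<rangle>\<^sub>d\<close> after its first \<open>\<nu> + 1\<close> factors.\<close>
  have gam: "\<gamma> (d - 1 - \<nu>) (n - \<nu>) * poly ((Delta w ^^ (d + 1)) (P (n - 1 - \<nu>))) x =
      ?c * (?g \<nu> * ?S (d - 1 - \<nu>) (\<nu> + 2))" if "\<nu> < d" for \<nu>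
  proof -
    have idx: "d + 1 = (\<nu> + 2) + (d - 1 - \<nu>)" "n - 1 - \<nu> = N + (d - 1 - \<nu>)"
      using that by (auto simp: n)
    have "d = (\<nu> + 1) + (d - 1 - \<nu>)" using that by simp
    then have "?c = falling_factorial (of_nat n) (\<nu> + 1)
        * falling_factorial (of_nat n - of_nat (\<nu> + 1)) (d - 1 - \<nu>)"
      by (metis falling_factorial_add)
    also have "of_nat n - of_nat (\<nu> + 1) = (of_nat (N + (d - 1 - \<nu>)) :: complex)"
      using that by (simp add: n of_nat_diff)
    finally have "?c = falling_factorial (of_nat n) (\<nu> + 1)
        * falling_factorial (of_nat (N + (d - 1 - \<nu>))) (d - 1 - \<nu>)" .
    moreover have "falling_factorial (of_nat n) (\<nu> + 1) \<noteq> 0"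
      using that \<open>d \<le> n\<close> by (intro falling_factorial_of_nat_nonzero) simp
    ultimately show ?thesis
      unfolding idx reduce by simp
  qed

  have "(Delta w ^^ (d + 1)) (P (n + 1)) =
      [:- \<beta> n + of_nat (d + 1) * w, 1:] * (Delta w ^^ (d + 1)) (P n)
      + smult (of_nat (d + 1)) ((Delta w ^^ d) (P n))
      - (\<Sum>\<nu><d. smult (\<gamma> (d - 1 - \<nu>) (n - \<nu>)) ((Delta w ^^ (d + 1)) (P (n - 1 - \<nu>))))"
  proof -
    have "(\<Sum>\<nu><d. if \<nu> + 1 \<le> n then smult (\<gamma> (d - 1 - \<nu>) (n - \<nu>)) (P (n - 1 - \<nu>)) else 0) =
        (\<Sum>\<nu><d. smult (\<gamma> (d - 1 - \<nu>) (n - \<nu>)) (P (n - 1 - \<nu>)))"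
      using \<open>d \<le> n\<close> by (intro sum.cong) auto
    then show ?thesis
      unfolding rec funpow_Delta_diff
      using funpow_Delta_linear_factor_mult [OF \<open>w \<noteq> 0\<close>, of d "- \<beta> n" "P n"]
      by (simp only: funpow_Delta_sum funpow_Delta_smult Suc_eq_plus1)
  qed
  then have "poly ((Delta w ^^ (d + 1)) (P (n + 1))) x =
      ?X * poly ((Delta w ^^ (d + 1)) (P n)) x + of_nat (d + 1) * poly ((Delta w ^^ d) (P n)) x
      - (\<Sum>\<nu><d. \<gamma> (d - 1 - \<nu>) (n - \<nu>) * poly ((Delta w ^^ (d + 1)) (P (n - 1 - \<nu>))) x)"
    by (simp only: poly_add poly_diff poly_mult poly_smult poly_sum poly_pCons poly_0)
       (simp add: algebra_simps)
  also have "(\<Sum>\<nu><d. \<gamma> (d - 1 - \<nu>) (n - \<nu>) * poly ((Delta w ^^ (d + 1)) (P (n - 1 - \<nu>))) x) =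
      ?c * (\<Sum>\<nu><d. ?g \<nu> * ?S (d - 1 - \<nu>) (\<nu> + 2))"
    by (subst sum_distrib_left, rule sum.cong [OF refl], rule gam) simp
  finally have "?c * (of_nat (N + d + 1) * ?S (d + 1) 0) =
      ?c * (?X * ?S d 1 + of_nat (d + 1) * ?S d 0 - (\<Sum>\<nu><d. ?g \<nu> * ?S (d - 1 - \<nu>) (\<nu> + 2)))"
    unfolding lhs lin1 lin0 by (simp only: ring_distribs mult_ac)
  then have "of_nat (N + d + 1) * ?S (d + 1) 0 =
      ?X * ?S d 1 + of_nat (d + 1) * ?S d 0 - (\<Sum>\<nu><d. ?g \<nu> * ?S (d - 1 - \<nu>) (\<nu> + 2))"
    using c by (simp only: mult_cancel_left) simp
  then have "of_nat N * ?A 0 = (?X - of_nat (d + 1) * \<alpha> * of_nat (N + 1)) * ?A 1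
      + (\<Sum>i = 1..d. (\<alpha> ^ i * (of_nat (d choose i) * ?X
                      - \<alpha> * of_nat (d + 1 choose (i + 1)) * of_nat (N + i + 1))
           - (\<Sum>j<i. of_nat (d - 1 - j choose (i - 1 - j)) * \<alpha> ^ (i - 1 - j) * ?g j)) * ?A (i + 1))"
    by (intro collect_difference_coefficients) (simp only: add_0 add.commute [of 1])
  moreover have low: "?A 0 = poly (P N) x" "?A 1 = poly (Delta w (P N)) x"
    by simp_all
  moreover have "?X - of_nat (d + 1) * \<alpha> * of_nat (N + 1) =
      x + of_nat (d + 1) * w - of_nat (d + 1) * \<alpha> * of_nat (N + 1) - \<beta> n"
    by simp
  ultimately show "of_nat (n - d) * poly (P (n - d)) x =
      (x + of_nat (d + 1) * w - of_nat (d + 1) * \<alpha> * of_nat (n - d + 1) - \<beta> n)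
        * poly (Delta w (P (n - d))) x
      + (\<Sum>i = 1..d.
          (\<alpha> ^ i * (of_nat (d choose i) * (x + of_nat (d + 1) * w - \<beta> n)
                    - \<alpha> * of_nat ((d + 1) choose (i + 1)) * of_nat (n - d + i + 1))
           - (\<Sum>j<i. of_nat ((d - 1 - j) choose (i - 1 - j)) * \<alpha> ^ (i - 1 - j)
                * (\<gamma> (d - 1 - j) (n - j) / falling_factorial (of_nat n) (j + 1))))
          * poly ((Delta w ^^ (i + 1)) (P (n - d))) x)"
    unfolding N_def [symmetric] by (simp only: low)
qed

end
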